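(* For all integers $n\ge 1$, $r\ge 0$ and $0\le\underline{k}\le\overline{k}$, the total number $\rho_{\underline{k}\le\overline{k}}(n,r)$ of runs of ones with length in $[\underline{k},\overline{k}]$ over all binary strings of length $n$ and Hamming weight $r$ is $$\rho_{\underline{k}\le\overline{k}}(n,r)=(n-r+1)\left(\binom{n-\underline{k}}{r-\underline{k}}-\binom{n-\overline{k}-1}{r-\overline{k}-1}\right)[\![n\ge r]\!].$$
   Context: $[\![P]\!]$ is the Iverson bracket ($1$ if $P$ is true, $0$ otherwise). The Hamming weight of a binary string is its number of ones. A run of ones is a maximal block of consecutive ones, flanked on each side by a zero or by the start/end of the string. Null runs (length $0$) of ones also count (when $\underline{k}=0$): there is one between every two consecutive zeros, one before an initial zero and one after a final zero; thus a string with $z$ zeros has exactly $z+1$ runs of ones (including null ones). Binomial coefficients: $\binom{a}{b}$ is the usual one for integers $a\ge b\ge 0$, and $\binom{a}{b}=0$ if $b<0$ or $a<b$. *)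

theory Defs
  imports Complex_Main
begin

text \<open>Binary strings are rendered as \<open>bool list\<close>, with \<open>True\<close> for one and \<open>False\<close> for zero.\<close>

definition binary_strings :: "nat \<Rightarrow> nat \<Rightarrow> bool list set" where
  "binary_strings n r = {w. length w = n \<and> count_list w True = r}"

text \<open>
  A run is identified by its starting position \<open>i\<close> (from 0) and its length \<open>l\<close>, so its ones occupy
  the positions \<open>i, ..., i + l - 1\<close>. Being flanked on both sides by a zero or by an end of the
  string makes the block maximal. For \<open>l = 0\<close> the same conditions say that the gap \<open>i\<close> lies between
  two consecutive zeros, before an initial zero or after a final zero (the empty string has one
  null run).
\<close>

definition is_run :: "bool list \<Rightarrow> nat \<Rightarrow> nat \<Rightarrow> bool" where
  "is_run w i l \<longleftrightarrow>
     i + l \<le> length w \<and>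
     (\<forall>j. i \<le> j \<and> j < i + l \<longrightarrow> w ! j = True) \<and>
     (i = 0 \<or> w ! (i - 1) = False) \<and>
     (i + l = length w \<or> w ! (i + l) = False)"

definition num_runs :: "nat \<Rightarrow> nat \<Rightarrow> bool list \<Rightarrow> nat" where
  "num_runs k K w = card {(i, l). is_run w i l \<and> k \<le> l \<and> l \<le> K}"

definition rho :: "nat \<Rightarrow> nat \<Rightarrow> nat \<Rightarrow> nat \<Rightarrow> nat" where
  "rho k K n r = (\<Sum>w\<in>binary_strings n r. num_runs k K w)"

text \<open>
  The arguments of the binomial coefficients may be negative, where truncated subtraction on
  \<open>nat\<close> would give wrong values.
\<close>

definition int_binomial :: "int \<Rightarrow> int \<Rightarrow> int" where
  "int_binomial a b = (if 0 \<le> b \<and> b \<le> a then int (nat a choose nat b) else 0)"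

end

theory Submission
  imports Defs
begin

text \<open>
  A run is determined by the position at which it starts, and a run of length at least \<open>m\<close> is a
  start followed by \<open>m\<close> ones.  Deleting these \<open>m\<close> ones leaves a start in a string of length
  \<open>n - m\<close> and weight \<open>r - m\<close>, and inserting \<open>m\<close> ones at a start undoes the deletion
  (\<open>sum_card_long_starts_add\<close>).  The deletion does not touch the \<open>n - r\<close> zeros, so the shorter
  string has exactly \<open>n - r + 1\<close> starts, one at position \<open>0\<close> and one after each zero
  (\<open>card_long_starts_0\<close>).  Hence the runs of length at least \<open>m\<close> number
  \<open>(n - r + 1) * ((n - m) choose (r - m))\<close> in total (\<open>sum_card_long_starts\<close>).

  The runs with length in \<open>[k, K]\<close> are those of length at least \<open>k\<close> without those of length at
  least \<open>K + 1\<close> (\<open>num_runs_add_long_starts\<close>), and the formula is the difference of the two counts.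
\<close>

section \<open>Runs and their starts\<close>

text \<open>
  No condition is put on position \<open>i + m\<close>, so membership says that the run starting at \<open>i\<close> has
  length at least \<open>m\<close>; for \<open>m = 0\<close> every run, null or not, contributes its start.
\<close>

definition long_starts :: "nat \<Rightarrow> bool list \<Rightarrow> nat set" where
  "long_starts m w =
    {i. i + m \<le> length w \<and> (i = 0 \<or> \<not> w ! (i - 1)) \<and> (\<forall>j. i \<le> j \<and> j < i + m \<longrightarrow> w ! j)}"

lemma finite_long_starts: "finite (long_starts m w)"
  by (rule finite_subset[of _ "{..length w}"]) (auto simp: long_starts_def)

lemma long_starts_antimono: "m \<le> m' \<Longrightarrow> long_starts m' w \<subseteq> long_starts m w"
  by (auto simp: long_starts_def)

lemma count_list_True_False: "count_list w True + count_list w False = length w"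
  by (induction w) auto

text \<open>The starts are position \<open>0\<close> and the positions just after a zero, the end of the string included.\<close>

lemma card_long_starts_0: "card (long_starts 0 w) = count_list w False + 1"
proof (induction w rule: rev_induct)
  case Nil
  have "long_starts 0 [] = {0}" by (auto simp: long_starts_def)
  then show ?case by simp
next
  case (snoc x w)
  have "long_starts 0 (w @ [x]) = long_starts 0 w \<union> (if x then {} else {Suc (length w)})"
    by (auto simp: long_starts_def nth_append le_Suc_eq)
  moreover have "Suc (length w) \<notin> long_starts 0 w"
    by (simp add: long_starts_def)
  ultimately show ?case
    using snoc finite_long_starts[of 0 w] by simp
qed

lemma is_run_length_unique:
  assumes "is_run w i l" and "is_run w i l'"
  shows "l = l'"
proof -
  have "\<not> l < l'" if "is_run w i l" "is_run w i l'" for l l'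
    using that by (force simp: is_run_def)
  then show ?thesis
    using assms by (meson linorder_neqE_nat)
qed

lemma long_start_extends_to_run:
  assumes "i \<in> long_starts m w"
  obtains l where "is_run w i l" and "m \<le> l"
proof -
  \<comment> \<open>The run ends at the first position from \<open>i\<close> on that is a zero or the end of the string.\<close>
  define P where "P l \<longleftrightarrow> i + l = length w \<or> \<not> w ! (i + l)" for l
  define l where "l = (LEAST l. P l)"
  have le: "i \<le> length w" and ones: "\<And>j. i \<le> j \<Longrightarrow> j < i + m \<Longrightarrow> w ! j" and im: "i + m \<le> length w"
    and start: "i = 0 \<or> \<not> w ! (i - 1)"
    using assms by (auto simp: long_starts_def)
  have Pend: "P (length w - i)"
    using le by (simp add: P_def)
  have Pl: "P l"
    unfolding l_def by (rule LeastI, rule Pend)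
  have bound: "l \<le> length w - i"
    unfolding l_def by (rule Least_le, rule Pend)
  have before: "w ! j" if "i \<le> j" "j < i + l" for j
  proof -
    have "\<not> P (j - i)"
      using that not_less_Least[of "j - i" P] by (simp add: l_def)
    then show ?thesis
      using that by (simp add: P_def)
  qed
  have "m \<le> l"
  proof (rule ccontr)
    assume "\<not> m \<le> l"
    then show False
      using Pl ones[of "i + l"] im by (simp add: P_def)
  qed
  moreover have "is_run w i l"
    using Pl bound before le start by (auto simp: is_run_def P_def)
  ultimately show ?thesis
    by (rule that[rotated])
qed

text \<open>
  Since a start determines the length of its run, the runs with length in \<open>[k, K]\<close> may be counted
  by the starts of runs that are at least \<open>k\<close> but not at least \<open>K + 1\<close> long.  The identity is
  written as a sum to stay clear of truncated subtraction.
\<close>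

lemma num_runs_add_long_starts:
  assumes "k \<le> K"
  shows "num_runs k K w + card (long_starts (K + 1) w) = card (long_starts k w)"
proof -
  let ?R = "{(i, l). is_run w i l \<and> k \<le> l \<and> l \<le> K}"
  have "inj_on fst ?R"
    by (auto simp: inj_on_def dest: is_run_length_unique)
  moreover have "fst ` ?R = long_starts k w - long_starts (K + 1) w"
  proof (intro equalityI subsetI)
    fix i assume "i \<in> fst ` ?R"
    then obtain l where l: "is_run w i l" "k \<le> l" "l \<le> K"
      by auto
    have "i \<in> long_starts k w"
      using l by (auto simp: is_run_def long_starts_def)
    moreover have "i \<notin> long_starts (K + 1) w"
    proof
      assume "i \<in> long_starts (K + 1) w"
      then obtain l' where "is_run w i l'" "K + 1 \<le> l'"
        by (rule long_start_extends_to_run)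
      then show False
        using is_run_length_unique[OF l(1)] l(3) by auto
    qed
    ultimately show "i \<in> long_starts k w - long_starts (K + 1) w"
      by blast
  next
    fix i assume i: "i \<in> long_starts k w - long_starts (K + 1) w"
    then obtain l where l: "is_run w i l" "k \<le> l"
      using long_start_extends_to_run by blast
    have "i \<in> long_starts l w"
      using l by (auto simp: is_run_def long_starts_def)
    then have "l \<le> K"
      using i long_starts_antimono[of "K + 1" l w] by (cases "K + 1 \<le> l") auto
    then show "i \<in> fst ` ?R"
      using l by force
  qed
  ultimately have "num_runs k K w = card (long_starts k w - long_starts (K + 1) w)"
    using card_image[of fst ?R] by (simp only: num_runs_def)
  then have "num_runs k K w = card (long_starts k w) - card (long_starts (K + 1) w)"
    using assms by (simp add: card_Diff_subset finite_long_starts long_starts_antimono)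
  moreover have "card (long_starts (K + 1) w) \<le> card (long_starts k w)"
    using assms by (intro card_mono finite_long_starts long_starts_antimono) simp
  ultimately show ?thesis
    by simp
qed

section \<open>Strings of given length and weight\<close>

lemma finite_binary_strings: "finite (binary_strings n r)"
  by (rule finite_subset[OF _ finite_lists_length_eq[of UNIV n]]) (auto simp: binary_strings_def)

lemma card_binary_strings: "card (binary_strings n r) = n choose r"
proof (induction n arbitrary: r)
  case 0
  have "binary_strings 0 r = (if r = 0 then {[]} else {})"
    by (auto simp: binary_strings_def)
  then show ?case by (cases r) auto
next
  case (Suc n)
  show ?case
  proof (cases r)
    case 0
    have "binary_strings (Suc n) 0 = (#) False ` binary_strings n 0"
      by (auto simp: binary_strings_def length_Suc_conv split: if_splits)
    then show ?thesis
      using Suc 0 by (simp add: card_image)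
  next
    case (Suc r')
    have "binary_strings (Suc n) (Suc r')
        = (#) True ` binary_strings n r' \<union> (#) False ` binary_strings n (Suc r')"
      by (auto simp: binary_strings_def length_Suc_conv split: if_splits)
    moreover have "(#) True ` binary_strings n r' \<inter> (#) False ` binary_strings n (Suc r') = {}"
      by auto
    ultimately show ?thesis
      using Suc.IH Suc by (simp add: card_Un_disjoint card_image finite_binary_strings)
  qed
qed

section \<open>Deleting ones from the front of a run\<close>

lemma weight_take_drop:
  "count_list (take i w) True + count_list (drop i w) True = count_list w True"
  by (metis append_take_drop_id count_list_append)

lemma count_list_replicate_True: "count_list (replicate m True) True = m"
  by (induction m) auto

lemma long_start_decompose:
  assumes "i \<in> long_starts m w"
  shows "w = take i w @ replicate m True @ drop (i + m) w"
  using assms by (intro nth_equalityI) (auto simp: long_starts_def nth_append)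

lemma long_starts_weight_ge:
  assumes "i \<in> long_starts m w"
  shows "m \<le> count_list w True"
proof -
  have "count_list w True
      = count_list (take i w) True + (m + count_list (drop (i + m) w) True)"
    by (subst long_start_decompose[OF assms]) (simp add: count_list_replicate_True)
  then show ?thesis by simp
qed

text \<open>
  Lengthening a run by \<open>m\<close> ones, inserted at its start, is inverse to shortening a run of length
  at least \<open>m\<close> by its first \<open>m\<close> ones; the position of the start is the same in both strings.
\<close>

lemma sum_card_long_starts_add:
  "(\<Sum>w\<in>binary_strings (n + m) (r + m). card (long_starts m w))
    = (\<Sum>w\<in>binary_strings n r. card (long_starts 0 w))"
proof -
  let ?A = "SIGMA w : binary_strings n r. long_starts 0 w"
  let ?B = "SIGMA w : binary_strings (n + m) (r + m). long_starts m w"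
  let ?ins = "\<lambda>(w, i). (take i w @ replicate m True @ drop i w, i)"
  let ?del = "\<lambda>(w, i). (take i w @ drop (i + m) w, i :: nat)"
  have "bij_betw ?ins ?A ?B"
  proof (rule bij_betw_byWitness[where f' = ?del])
    show "\<forall>a\<in>?A. ?del (?ins a) = a"
      by (auto simp: long_starts_def)
    have "?ins (?del (w, i)) = (w, i)" if i: "i \<in> long_starts m w" for w i
    proof -
      have "i \<le> length w"
        using i by (simp add: long_starts_def)
      then show ?thesis
        using long_start_decompose[OF i] by simp
    qed
    then show "\<forall>b\<in>?B. ?ins (?del b) = b"
      by (simp only: Ball_def mem_Sigma_iff split_paired_All) blast
    have "take i w @ replicate m True @ drop i w \<in> binary_strings (n + m) (r + m)
          \<and> i \<in> long_starts m (take i w @ replicate m True @ drop i w)"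
      if "w \<in> binary_strings n r" "i \<in> long_starts 0 w" for w i
    proof
      have i: "i \<le> length w" "i = 0 \<or> \<not> w ! (i - 1)"
        using that(2) by (auto simp: long_starts_def)
      show "take i w @ replicate m True @ drop i w \<in> binary_strings (n + m) (r + m)"
        using that(1) i(1) weight_take_drop[of i w]
        by (simp add: binary_strings_def count_list_replicate_True)
      show "i \<in> long_starts m (take i w @ replicate m True @ drop i w)"
        using i by (cases i) (auto simp: long_starts_def nth_append)
    qed
    then show "?ins ` ?A \<subseteq> ?B"
      by (simp only: image_subset_iff Ball_def split_paired_All mem_Sigma_iff prod.case) blast
    have "take i w @ drop (i + m) w \<in> binary_strings n r
          \<and> i \<in> long_starts 0 (take i w @ drop (i + m) w)"
      if w: "w \<in> binary_strings (n + m) (r + m)" and i: "i \<in> long_starts m w" for w i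
    proof -
      have "count_list w True
          = count_list (take i w) True + (m + count_list (drop (i + m) w) True)"
        by (subst long_start_decompose[OF i]) (simp add: count_list_replicate_True)
      then show ?thesis
        using w i by (auto simp: long_starts_def binary_strings_def nth_append)
    qed
    then show "?del ` ?B \<subseteq> ?A"
      by (simp only: image_subset_iff Ball_def split_paired_All mem_Sigma_iff prod.case) blast
  qed
  then have "card ?A = card ?B"
    by (rule bij_betw_same_card)
  then show ?thesis
    by (simp add: finite_binary_strings finite_long_starts)
qed

lemma sum_card_long_starts:
  "(\<Sum>w\<in>binary_strings n r. card (long_starts m w))
    = (if m \<le> r \<and> r \<le> n then (n - r + 1) * ((n - m) choose (r - m)) else 0)"
proof (cases "m \<le> r \<and> r \<le> n")
  case True
  have "(\<Sum>w\<in>binary_strings n r. card (long_starts m w))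
      = (\<Sum>w\<in>binary_strings (n - m) (r - m). card (long_starts 0 w))"
    using sum_card_long_starts_add[of m "n - m" "r - m"] True by simp
  also have "\<dots> = (\<Sum>w\<in>binary_strings (n - m) (r - m). n - r + 1)"
  proof (rule sum.cong[OF refl])
    fix w assume "w \<in> binary_strings (n - m) (r - m)"
    then show "card (long_starts 0 w) = n - r + 1"
      using True count_list_True_False[of w]
      by (auto simp: card_long_starts_0 binary_strings_def)
  qed
  also have "\<dots> = (n - r + 1) * ((n - m) choose (r - m))"
    by (simp add: card_binary_strings)
  finally show ?thesis
    using True by simp
next
  case False
  have "long_starts m w = {}" if "w \<in> binary_strings n r" for w
    using that False long_starts_weight_ge[of _ m w] count_le_length[of w True]
    by (auto simp: binary_strings_def)
  then show ?thesis
    using False by auto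
qed

theorem mainTheorem19:
  fixes n r k K :: nat
  assumes "n \<ge> 1" and "k \<le> K"
  shows "int (rho k K n r) =
    (int n - int r + 1) *
    (int_binomial (int n - int k) (int r - int k)
     - int_binomial (int n - int K - 1) (int r - int K - 1)) *
    of_bool (n \<ge> r)"
proof -
  let ?S = "\<lambda>m. \<Sum>w\<in>binary_strings n r. card (long_starts m w)"
  have S: "int (?S m)
      = (int n - int r + 1) * int_binomial (int n - int m) (int r - int m) * of_bool (n \<ge> r)" for m
  proof (cases "m \<le> r \<and> r \<le> n")
    case True
    then have "int_binomial (int n - int m) (int r - int m) = int ((n - m) choose (r - m))"
      by (simp add: int_binomial_def nat_diff_distrib)
    moreover have "int (n - r + 1) = int n - int r + 1"
      using True by linarith
    moreover have "?S m = (n - r + 1) * ((n - m) choose (r - m))"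
      using True by (simp add: sum_card_long_starts)
    ultimately show ?thesis
      using True by (simp only: of_nat_mult of_bool_eq mult_1_right)
  next
    case False
    then show ?thesis
      unfolding sum_card_long_starts by (auto simp: int_binomial_def)
  qed
  have "rho k K n r + ?S (K + 1) = ?S k"
    unfolding rho_def sum.distrib[symmetric] num_runs_add_long_starts[OF \<open>k \<le> K\<close>] ..
  then have "int (rho k K n r) = int (?S k) - int (?S (K + 1))"
    by linarith
  then show ?thesis
    unfolding S by (simp add: algebra_simps of_bool_def)
qed

end
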